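(* Let $G$ be a graph of order $n$, size $m\ge 1$, and chromatic number $\chi$. If $\alpha\in[0,1]$, then \[ \lambda_{\min}(A_{\alpha}(G))\leq\frac{(\alpha\chi-1)\,2m}{(\chi-1)\,n}. \]
   Context: For a finite simple graph $G$, $A(G)$ is its adjacency matrix and $D(G)$ is the diagonal matrix of its vertex degrees. For real $\alpha\in[0,1]$, $A_{\alpha}(G)=\alpha D(G)+(1-\alpha)A(G)$, and $\lambda_{\min}(A_\alpha(G))$ is its smallest eigenvalue. The size of $G$ is its number of edges. *)

theory Defs
  imports "HOL-Analysis.Analysis"
begin

text \<open>
  The vertex set of a graph is a whole finite type \<open>'v\<close>, so its order is \<open>CARD('v)\<close> and
  its matrices have type \<open>real^'v^'v\<close>; a graph is given by its set of edges, which are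
  two-element sets of vertices.
\<close>

definition simple_graph :: "'v::finite set set \<Rightarrow> bool" where
  "simple_graph E \<longleftrightarrow> (\<forall>e\<in>E. card e = 2)"

definition vertex_degree :: "'v::finite set set \<Rightarrow> 'v \<Rightarrow> nat" where
  "vertex_degree E v = card {e \<in> E. v \<in> e}"

definition proper_colouring :: "'v::finite set set \<Rightarrow> nat \<Rightarrow> ('v \<Rightarrow> nat) \<Rightarrow> bool" where
  "proper_colouring E k c \<longleftrightarrow> (\<forall>v. c v < k) \<and> (\<forall>u v. {u, v} \<in> E \<longrightarrow> c u \<noteq> c v)"

definition chromatic_number :: "'v::finite set set \<Rightarrow> nat" where
  "chromatic_number E = (LEAST k. \<exists>c. proper_colouring E k c)"

definition adjacency_matrix :: "'v::finite set set \<Rightarrow> real^'v^'v" where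
  "adjacency_matrix E = (\<chi> u v. if {u, v} \<in> E then 1 else 0)"

definition degree_matrix :: "'v::finite set set \<Rightarrow> real^'v^'v" where
  "degree_matrix E = (\<chi> u v. if u = v then real (vertex_degree E u) else 0)"

definition A_alpha :: "real \<Rightarrow> 'v::finite set set \<Rightarrow> real^'v^'v" where
  "A_alpha \<alpha> E = \<alpha> *\<^sub>R degree_matrix E + (1 - \<alpha>) *\<^sub>R adjacency_matrix E"

definition eigenvalue :: "real^'n^'n \<Rightarrow> real \<Rightarrow> bool" where
  "eigenvalue M c \<longleftrightarrow> (\<exists>x. x \<noteq> 0 \<and> M *v x = c *\<^sub>R x)"

text \<open>
  For symmetric \<open>M\<close>, such as \<open>A_alpha \<alpha> E\<close>, all eigenvalues are real and the set below is
  finite and nonempty, as \<open>Min\<close> requires.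
\<close>

definition lambda_min :: "real^'n^'n \<Rightarrow> real" where
  "lambda_min M = Min {c. eigenvalue M c}"

end

theory Submission
  imports Defs
begin

text \<open>
  For a symmetric matrix the smallest eigenvalue bounds every Rayleigh quotient from below. Given a
  proper colouring with \<open>\<chi>\<close> colours, take for each colour \<open>k\<close> the test vector with value \<open>\<chi> - 1\<close> on
  the class of \<open>k\<close> and \<open>- 1\<close> elsewhere. Summed over \<open>k\<close>, the products of the entries at \<open>u\<close> and \<open>v\<close>
  give \<open>\<chi> (\<chi> - 1)\<close> if \<open>u\<close> and \<open>v\<close> have the same colour and \<open>- \<chi>\<close> otherwise. So the quadratic forms
  sum to \<open>2 m \<chi> (\<alpha> \<chi> - 1)\<close> and the squared norms to \<open>n \<chi> (\<chi> - 1)\<close>, and the quotient of the two sums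
  is the claimed bound.
\<close>

lemma symmetric_inner_matrix:
  fixes M :: "real^'n^'n"
  assumes "transpose M = M"
  shows "x \<bullet> (M *v y) = y \<bullet> (M *v x)"
  by (metis assms dot_lmul_matrix inner_commute transpose_matrix_vector)

text \<open>Needed because \<open>Min\<close> in \<open>lambda_min\<close> bounds the eigenvalues
  only if their set is finite. Eigenvectors for distinct eigenvalues are orthogonal, hence
  independent, and an independent set in finite dimension is finite.\<close>

lemma finite_eigenvalues_symmetric:
  fixes M :: "real^'n^'n"
  assumes sym: "transpose M = M"
  shows "finite {c. eigenvalue M c}"
proof -
  define f where "f c = (SOME x. x \<noteq> 0 \<and> M *v x = c *\<^sub>R x)" for c
  have f: "f c \<noteq> 0 \<and> M *v f c = c *\<^sub>R f c" if "eigenvalue M c" for c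
    using that unfolding f_def eigenvalue_def by (rule someI_ex)
  have orth: "f c \<bullet> f d = 0" if "eigenvalue M c" "eigenvalue M d" "c \<noteq> d" for c d
  proof -
    \<comment> \<open>Both sides equal the same bilinear value, with the matrix applied to
      \<open>f d\<close> on the left and to \<open>f c\<close> on the right.\<close>
    have "d * (f c \<bullet> f d) = c * (f c \<bullet> f d)"
      using symmetric_inner_matrix[OF sym, of "f c" "f d"] f[OF that(1)] f[OF that(2)]
      by (simp add: inner_commute)
    with \<open>c \<noteq> d\<close> show ?thesis by simp
  qed
  have inj: "inj_on f {c. eigenvalue M c}"
    using orth f by (intro inj_onI) (metis inner_eq_zero_iff mem_Collect_eq)
  have "pairwise orthogonal (f ` {c. eigenvalue M c})"
    using orth by (auto simp: pairwise_def orthogonal_def)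
  then have "independent (f ` {c. eigenvalue M c})"
    using f by (intro pairwise_orthogonal_independent) auto
  then have "finite (f ` {c. eigenvalue M c})"
    using independent_bound by blast
  with inj show ?thesis by (simp add: finite_image_iff)
qed

text \<open>Such an \<open>x\<close> minimises the form, so its derivative at \<open>x\<close>
  vanishes in every direction; in the direction \<open>N *v x\<close> it is twice the squared norm
  of \<open>N *v x\<close>.\<close>

lemma psd_form_zero_imp_kernel:
  fixes N :: "real^'n^'n"
  assumes sym: "transpose N = N"
    and psd: "\<And>y. 0 \<le> y \<bullet> (N *v y)"
    and zero: "x \<bullet> (N *v x) = 0"
  shows "N *v x = 0"
proof -
  define y where "y = N *v x"
  define a where "a = y \<bullet> y"
  define b where "b = y \<bullet> (N *v y)"
  have b: "0 \<le> b" unfolding b_def by (rule psd)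
  have xy: "x \<bullet> (N *v y) = a"
    using symmetric_inner_matrix[OF sym, of x y] by (simp add: a_def y_def)
  have form: "0 \<le> 2 * t * a + t\<^sup>2 * b" for t
  proof -
    have "(x + t *\<^sub>R y) \<bullet> (N *v (x + t *\<^sub>R y)) = 2 * t * a + t\<^sup>2 * b"
      using xy zero
      by (simp add: matrix_vector_right_distrib matrix_vector_mult_scaleR inner_add_left
          inner_add_right b_def power2_eq_square algebra_simps)
        (simp add: a_def y_def)
    then show ?thesis using psd[of "x + t *\<^sub>R y"] by simp
  qed
  \<comment> \<open>The quadratic in \<open>t\<close> is minimal at \<open>- a / b\<close> when
    \<open>b\<close> is positive; \<open>b + 1\<close> in the denominator also covers
    \<open>b = 0\<close> and still makes the value negative unless \<open>a = 0\<close>.\<close>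
  have "2 * (- a / (b + 1)) * a + (- a / (b + 1))\<^sup>2 * b = - a\<^sup>2 * (b + 2) / (b + 1)\<^sup>2"
    using b by (simp add: divide_simps power2_eq_square) (simp add: algebra_simps)
  with form[of "- a / (b + 1)"] have "0 \<le> - a\<^sup>2 * (b + 2) / (b + 1)\<^sup>2" by simp
  with b have "a\<^sup>2 * (b + 2) \<le> 0"
    by (simp add: divide_simps)
  with b have "a = 0"
    by (metis add_nonneg_pos mult_le_0_iff not_le power2_less_eq_zero_iff zero_less_numeral)
  then show ?thesis by (simp add: a_def y_def)
qed

text \<open>By compactness the form attains its minimum \<open>c\<close> on the unit sphere. The
  minimiser turns out to be an eigenvector for \<open>c\<close>, so \<open>lambda_min M\<close> is
  at most \<open>c\<close>, which bounds all Rayleigh quotients from below.\<close>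

lemma lambda_min_rayleigh:
  fixes M :: "real^'n^'n"
  assumes sym: "transpose M = M"
  shows "lambda_min M * (x \<bullet> x) \<le> x \<bullet> (M *v x)"
proof -
  let ?S = "sphere (0::real^'n) 1"
  have "continuous_on ?S (\<lambda>x. x \<bullet> (M *v x))"
    by (intro continuous_intros matrix_vector_mult_linear_continuous_on)
  moreover have "?S \<noteq> {}" by simp
  ultimately obtain z where z: "z \<in> ?S" and min: "\<And>y. y \<in> ?S \<Longrightarrow> z \<bullet> (M *v z) \<le> y \<bullet> (M *v y)"
    using continuous_attains_inf[of ?S] compact_sphere by blast
  define c where "c = z \<bullet> (M *v z)"
  have ray: "c * (y \<bullet> y) \<le> y \<bullet> (M *v y)" for y
  proof (cases "y = 0")
    case False
    have "c \<le> (y /\<^sub>R norm y) \<bullet> (M *v (y /\<^sub>R norm y))"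
      unfolding c_def using False by (intro min) simp
    also have "\<dots> = (y \<bullet> (M *v y)) / (y \<bullet> y)"
      by (simp add: matrix_vector_mult_scaleR divide_simps dot_square_norm power2_eq_square)
    finally show ?thesis using False by (simp add: divide_simps split: if_splits)
  qed simp
  \<comment> \<open>The shift by \<open>c\<close> makes the form nonnegative with a zero at
    \<open>z\<close>, so \<open>z\<close> lies in the kernel of \<open>N\<close>.\<close>
  define N where "N = M - c *\<^sub>R mat 1"
  have Nv: "N *v y = M *v y - c *\<^sub>R y" for y
    unfolding N_def by (simp add: matrix_vector_mult_diff_rdistrib scaleR_matrix_vector_assoc[symmetric])
  have "transpose N = N"
    using sym unfolding N_def by (simp add: transpose_def mat_def vec_eq_iff)
  moreover have "0 \<le> y \<bullet> (N *v y)" for y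
    using ray[of y] by (simp add: Nv inner_diff_right)
  moreover have "z \<bullet> (N *v z) = 0"
    using z by (simp add: Nv inner_diff_right c_def dot_square_norm)
  ultimately have "N *v z = 0" by (rule psd_form_zero_imp_kernel)
  moreover have "z \<noteq> 0" using z by auto
  ultimately have "eigenvalue M c" unfolding eigenvalue_def using Nv by auto
  then have "lambda_min M \<le> c"
    unfolding lambda_min_def using finite_eigenvalues_symmetric[OF sym] by (simp add: Min_le)
  then have "lambda_min M * (x \<bullet> x) \<le> c * (x \<bullet> x)" by (simp add: mult_right_mono)
  also have "\<dots> \<le> x \<bullet> (M *v x)" by (rule ray)
  finally show ?thesis .
qed

lemma transpose_A_alpha: "transpose (A_alpha \<alpha> E) = A_alpha \<alpha> E"
  by (simp add: A_alpha_def degree_matrix_def adjacency_matrix_def transpose_def vec_eq_iff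
      insert_commute)

lemma sum_vertex_degree:
  fixes E :: "'v::finite set set"
  assumes "simple_graph E"
  shows "(\<Sum>u\<in>UNIV. vertex_degree E u) = 2 * card E"
proof -
  have "(\<Sum>u\<in>UNIV. vertex_degree E u) = (\<Sum>u\<in>UNIV. \<Sum>e\<in>E. if u \<in> e then 1 else 0)"
    by (simp add: vertex_degree_def sum.If_cases Int_def)
  also have "\<dots> = (\<Sum>e\<in>E. \<Sum>u\<in>UNIV. if u \<in> e then 1 else 0)"
    by (rule sum.swap)
  also have "\<dots> = (\<Sum>e\<in>E. 2)"
    using assms by (intro sum.cong) (auto simp: simple_graph_def sum.If_cases)
  finally show ?thesis by simp
qed

text \<open>Degrees count edges, whereas row sums of the adjacency matrix count neighbours; mapping
  a neighbour \<open>v\<close> to the edge \<open>{u, v}\<close> matches the two.\<close>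

lemma vertex_degree_eq_card_neighbours:
  assumes "simple_graph E"
  shows "vertex_degree E u = card {v. {u, v} \<in> E}"
proof -
  have "{e \<in> E. u \<in> e} = (\<lambda>v. {u, v}) ` {v. {u, v} \<in> E}"
  proof (intro set_eqI iffI)
    fix e assume e: "e \<in> {e \<in> E. u \<in> e}"
    then have "card e = 2" using assms by (simp add: simple_graph_def)
    with e show "e \<in> (\<lambda>v. {u, v}) ` {v. {u, v} \<in> E}"
      by (auto simp: card_2_iff insert_commute)
  qed auto
  moreover have "inj_on (\<lambda>v. {u, v}) {v. {u, v} \<in> E}"
    by (auto simp: inj_on_def doubleton_eq_iff)
  ultimately show ?thesis unfolding vertex_degree_def by (simp add: card_image)
qed

text \<open>The \<open>LEAST\<close> is attained once some number of colours works, and giving all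
  vertices different colours is proper because an edge has two distinct ends.\<close>

lemma proper_colouring_chromatic_number:
  fixes E :: "'v::finite set set"
  assumes "simple_graph E"
  obtains c where "proper_colouring E (chromatic_number E) c"
proof -
  obtain f :: "'v \<Rightarrow> nat" where f: "bij_betw f UNIV {..<CARD('v)}"
    using ex_bij_betw_finite_nat[of "UNIV::'v set"] by (auto simp: atLeast0LessThan)
  have "proper_colouring E CARD('v) f"
    unfolding proper_colouring_def
  proof (intro conjI allI impI)
    show "f v < CARD('v)" for v using f by (auto simp: bij_betw_def)
    fix u v assume "{u, v} \<in> E"
    then have "u \<noteq> v" using assms by (auto simp: simple_graph_def)
    then show "f u \<noteq> f v" using f by (auto simp: bij_betw_def dest: injD)
  qed
  then have "\<exists>k c. proper_colouring E k c" by blast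
  then have "\<exists>c. proper_colouring E (chromatic_number E) c"
    unfolding chromatic_number_def by (rule LeastI_ex)
  then show thesis using that by blast
qed

text \<open>The factors are the entries of the test vector of colour \<open>l\<close> at vertices of
  colours \<open>i\<close> and \<open>j\<close>.\<close>

lemma sum_colour_products:
  assumes "i < k" "j < k"
  shows "(\<Sum>l<k. ((if i = l then real k else 0) - 1) * ((if j = l then real k else 0) - 1))
    = (if i = j then real k * (real k - 1) else - real k)"
proof -
  have "(\<Sum>l<k. ((if i = l then real k else 0) - 1) * ((if j = l then real k else 0) - 1))
    = (\<Sum>l<k. (if i = l then if i = j then (real k)\<^sup>2 else 0 else 0)
        - (if i = l then real k else 0) - (if j = l then real k else 0) + 1)"
    by (intro sum.cong) (auto simp: power2_eq_square algebra_simps)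
  also have "\<dots> = (if i = j then (real k)\<^sup>2 else 0) - real k - real k + real k"
    using assms by (simp add: sum.distrib sum_subtractf)
  also have "\<dots> = (if i = j then real k * (real k - 1) else - real k)"
    by (simp add: power2_eq_square algebra_simps)
  finally show ?thesis .
qed

theorem theorem1:
  fixes E :: "'v::finite set set" and \<alpha> :: real and n m chi :: nat
  assumes "simple_graph E"
    and "n = CARD('v)"
    and "m = card E"
    and "m \<ge> 1"
    and "chi = chromatic_number E"
    and "0 \<le> \<alpha>" and "\<alpha> \<le> 1"
  shows "lambda_min (A_alpha \<alpha> E)
    \<le> ((\<alpha> * real chi - 1) * (2 * real m)) / ((real chi - 1) * real n)"
proof -
  let ?M = "A_alpha \<alpha> E"
  define k where "k = real chi"
  obtain c where c: "proper_colouring E chi c"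
    using proper_colouring_chromatic_number assms(1,5) by metis
  then have c_less: "c v < chi" and c_neq: "{u, v} \<in> E \<Longrightarrow> c u \<noteq> c v" for u v
    by (auto simp: proper_colouring_def)
  obtain e where "e \<in> E" using assms(3,4) by fastforce
  moreover from this have "card e = 2" using assms(1) by (simp add: simple_graph_def)
  ultimately obtain a b where "{a, b} \<in> E" by (auto simp: card_2_iff)
  then have "c a \<noteq> c b" by (rule c_neq)
  \<comment> \<open>An edge forces two colours, which makes the denominator \<open>k - 1\<close>
    positive.\<close>
  with c_less[of a] c_less[of b] have chi: "2 \<le> chi" by linarith
  have n: "0 < n" by (simp add: assms(2))
  define x :: "nat \<Rightarrow> real^'v" where "x l = (\<chi> v. (if c v = l then k else 0) - 1)" for l
  have prods: "(\<Sum>l<chi. x l $ u * x l $ v) = (if c u = c v then k * (k - 1) else - k)" for u v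
    unfolding x_def k_def using sum_colour_products[OF c_less c_less, of u v] by simp
  have norms: "(\<Sum>l<chi. x l \<bullet> x l) = real n * (k * (k - 1))"
  proof -
    have "(\<Sum>l<chi. x l \<bullet> x l) = (\<Sum>v\<in>UNIV. \<Sum>l<chi. x l $ v * x l $ v)"
      unfolding inner_vec_def inner_real_def by (rule sum.swap)
    then show ?thesis by (simp add: prods assms(2))
  qed
  have deg: "(\<Sum>u\<in>UNIV. real (vertex_degree E u)) = 2 * real m"
    using sum_vertex_degree[OF assms(1)] assms(3) by (simp flip: of_nat_sum)
  have nbs: "(\<Sum>v\<in>UNIV. if {u, v} \<in> E then 1 else 0) = real (vertex_degree E u)" for u
    by (simp add: vertex_degree_eq_card_neighbours[OF assms(1)] sum.If_cases)
  have forms: "(\<Sum>l<chi. x l \<bullet> (?M *v x l)) = 2 * real m * k * (\<alpha> * k - 1)"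
  proof -
    have "(\<Sum>l<chi. x l \<bullet> (?M *v x l)) = (\<Sum>l<chi. \<Sum>u\<in>UNIV. \<Sum>v\<in>UNIV. ?M $ u $ v * (x l $ u * x l $ v))"
      by (simp add: inner_vec_def matrix_vector_mult_def sum_distrib_left mult.left_commute)
    also have "\<dots> = (\<Sum>u\<in>UNIV. \<Sum>l<chi. \<Sum>v\<in>UNIV. ?M $ u $ v * (x l $ u * x l $ v))"
      by (rule sum.swap)
    also have "\<dots> = (\<Sum>u\<in>UNIV. \<Sum>v\<in>UNIV. \<Sum>l<chi. ?M $ u $ v * (x l $ u * x l $ v))"
      by (intro sum.cong refl sum.swap)
    also have "\<dots> = (\<Sum>u\<in>UNIV. \<Sum>v\<in>UNIV. ?M $ u $ v * (if c u = c v then k * (k - 1) else - k))"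
      by (simp only: prods flip: sum_distrib_left)
    \<comment> \<open>Properness enters here: equal colours contribute only on the diagonal, where
      the entry is \<alpha> times the degree, and every edge joins different colours and so has
      weight \<open>- k\<close>.\<close>
    also have "\<dots> = (\<Sum>u\<in>UNIV. \<Sum>v\<in>UNIV.
        (if u = v then \<alpha> * k * (k - 1) * real (vertex_degree E u) else 0)
        - (1 - \<alpha>) * k * (if {u, v} \<in> E then 1 else 0))"
      by (intro sum.cong refl)
        (auto simp: A_alpha_def degree_matrix_def adjacency_matrix_def algebra_simps dest: c_neq)
    \<comment> \<open>Each row of the adjacency matrix sums to the degree, so both terms become
      multiples of it; the common coefficient equals \<open>k * (\<alpha> * k - 1)\<close>.\<close>
    also have "\<dots> = (\<Sum>u\<in>UNIV. (\<alpha> * k * (k - 1) - (1 - \<alpha>) * k) * real (vertex_degree E u))"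
      by (simp add: sum_subtractf nbs left_diff_distrib flip: sum_distrib_left)
    also have "\<dots> = (\<alpha> * k * (k - 1) - (1 - \<alpha>) * k) * (2 * real m)"
      by (simp only: deg flip: sum_distrib_left)
    finally show ?thesis by (simp add: algebra_simps)
  qed
  have "(\<Sum>l<chi. lambda_min ?M * (x l \<bullet> x l)) \<le> (\<Sum>l<chi. x l \<bullet> (?M *v x l))"
    by (intro sum_mono lambda_min_rayleigh transpose_A_alpha)
  then have "lambda_min ?M * (real n * (k * (k - 1))) \<le> 2 * real m * k * (\<alpha> * k - 1)"
    by (simp only: norms forms flip: sum_distrib_left)
  then have "k * (lambda_min ?M * ((k - 1) * real n)) \<le> k * ((\<alpha> * k - 1) * (2 * real m))"
    by (simp add: mult_ac)
  moreover have "0 < k" "0 < (k - 1) * real n" using chi n by (auto simp: k_def)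
  ultimately show ?thesis
    by (simp add: pos_le_divide_eq flip: k_def)
qed

end
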